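(* Let $K$ be a field, $L=L_0\oplus L_1$ a (left) Leibniz superalgebra over $K$ and $M=M_0\oplus M_1$ a module over $L$. The set $F(L,M)$ of all equivalence classes of extensions of $L$ by $M$ is in one-to-one correspondence with the cohomology group $H_0^2(L;M)$. The correspondence $\omega:H_0^2(L;M)\to F(L,M)$ is obtained by assigning to each cocycle $h\in Z_0^2(L;M)$ the (equivalence class of the) extension $$0\to M\xrightarrow{\,i\,}\mathcal{E}_h\xrightarrow{\,\pi\,}L\to0,\qquad i(m)=(0,m),\quad \pi(x,m)=x,$$ where $\mathcal{E}_h=L\oplus M$ as a $\mathbb{Z}_2$-graded vector space, with multiplication $$[(x,m),(y,n)]=([x,y],\,[x,n]+[m,y]+h(x,y)).$$
   Context: Fix a field $K$. In a $\mathbb{Z}_2$-graded space, a homogeneous element appearing in an exponent of $-1$ stands for its degree: $(-1)^{ab}=(-1)^{\deg(a)\deg(b)}$. Formulas with such signs are stated for homogeneous arguments and extended (multi)linearly. A (left) Leibniz superalgebra is a $\mathbb{Z}_2$-graded $K$-vector space $L=L_0\oplus L_1$ with a bilinear map $[-,-]:L\times L\to L$ such that $[L_\alpha,L_\beta]\subseteq L_{\alpha+\beta}$ and $[[a,b],c]=[a,[b,c]]-(-1)^{ab}[b,[a,c]]$ for all homogeneous $a,b,c\in L$. A homomorphism of Leibniz superalgebras is a degree-preserving $K$-linear map $f$ with $f([a,b])=[f(a),f(b)]$. A Leibniz superalgebra is abelian if its bracket is zero. A module over $L$ is a $\mathbb{Z}_2$-graded $K$-vector space $M=M_0\oplus M_1$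 with two bilinear maps $[-,-]:L\times M\to M$ and $[-,-]:M\times L\to M$ satisfying $[L_\alpha,M_\beta]\subseteq M_{\alpha+\beta}$, $[M_\beta,L_\alpha]\subseteq M_{\alpha+\beta}$, and for all homogeneous $a,b\in L$, $m\in M$: (1) $[[a,b],m]=[a,[b,m]]-(-1)^{ab}[b,[a,m]]$; (2) $[[a,m],b]=[a,[m,b]]-(-1)^{am}[m,[a,b]]$; (3) $[[m,a],b]=[m,[a,b]]-(-1)^{ma}[a,[m,b]]$. For $n\ge 1$, $C_0^n(L;M)$ is the space of $n$-linear maps $f:L\times\cdots\times L\to M$ that are homogeneous of degree $0$, i.e. $\deg f(x_1,\dots,x_n)=\sum_i\deg(x_i)$ for homogeneous $x_i$. For $f\in C_0^1(L;M)$, $$\delta^1f(x_1,x_2)=-f([x_1,x_2])+[x_1,f(x_2)]+[f(x_1),x_2],$$ and for $g\in C_0^2(L;M)$ and homogeneous $x_i$, $$\begin{aligned}\delta^2g(x_1,x_2,x_3)={}&-g([x_1,x_2],x_3)-(-1)^{x_1x_2}g(x_2,[x_1,x_3])+g(x_1,[x_2,x_3])\\&+[x_1,g(x_2,x_3)]-(-1)^{x_1x_2}[x_2,g(x_1,x_3)]-[g(x_1,x_2),x_3].\end{aligned}$$ $Z_0^2(L;M)=\{g\in C_0^2(L;M):\delta^2g=0\}$ (cocycles), $B_0^2(L;M)=\delta^1(C_0^1(L;M))$, and $H_0^2(L;M)=Z_0^2(L;M)/B_0^2(L;M)$. Regard $M$ as an abelian Leibniz superalgebra. An extension of $L$ by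 $M$ is an exact sequence $0\to M\xrightarrow{i}\mathcal{E}\xrightarrow{\pi}L\to0$ of Leibniz superalgebras and homomorphisms such that $[x,i(m)]=i([\pi(x),m])$ and $[i(m),x]=i([m,\pi(x)])$ for all $x\in\mathcal{E}$, $m\in M$. Two extensions $0\to M\to\mathcal{E}^k\to L\to0$ $(k=1,2)$ are equivalent if there is a Leibniz superalgebra isomorphism $\psi:\mathcal{E}^1\to\mathcal{E}^2$ compatible with the inclusions of $M$ and the projections to $L$ (i.e. the diagram with $\mathrm{Id}_M$, $\psi$, $\mathrm{Id}_L$ as vertical maps commutes). $F(L,M)$ denotes the set of equivalence classes of extensions of $L$ by $M$. *)

theory Defs
  imports Complex_Main "HOL-Library.Z2" "HOL-Library.Product_Plus"
begin

text \<open>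
  The underlying vector space of a structure is a whole type of class \<^class>\<open>ab_group_add\<close>
  together with a scalar multiplication. Degrees are elements of the two-element field
  \<^typ>\<open>bit\<close>, so that sums and products of degrees are taken modulo 2.
\<close>

record ('k, 'v) superspace =
  scl :: "'k \<Rightarrow> 'v \<Rightarrow> 'v"
  part :: "bit \<Rightarrow> 'v set"

record ('k, 'v) superalgebra = "('k, 'v) superspace" +
  brk :: "'v \<Rightarrow> 'v \<Rightarrow> 'v"

record ('k, 'l, 'm) supermodule = "('k, 'm) superspace" +
  lact :: "'l \<Rightarrow> 'm \<Rightarrow> 'm"
  ract :: "'m \<Rightarrow> 'l \<Rightarrow> 'm"

definition superspace ::
    "('k::field, 'v::ab_group_add, 'z) superspace_scheme \<Rightarrow> bool" where
  "superspace V \<longleftrightarrow>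
     vector_space (scl V) \<and>
     (\<forall>\<alpha>. module.subspace (scl V) (part V \<alpha>)) \<and>
     part V 0 \<inter> part V 1 = {0} \<and>
     (\<forall>v. \<exists>a\<in>part V 0. \<exists>b\<in>part V 1. v = a + b)"

definition bilinear_map ::
    "('k::field \<Rightarrow> 'a::ab_group_add \<Rightarrow> 'a) \<Rightarrow> ('k \<Rightarrow> 'b::ab_group_add \<Rightarrow> 'b) \<Rightarrow>
     ('k \<Rightarrow> 'c::ab_group_add \<Rightarrow> 'c) \<Rightarrow> ('a \<Rightarrow> 'b \<Rightarrow> 'c) \<Rightarrow> bool" where
  "bilinear_map s1 s2 s3 f \<longleftrightarrow>
     (\<forall>x. Vector_Spaces.linear s2 s3 (f x)) \<and>
     (\<forall>y. Vector_Spaces.linear s1 s3 (\<lambda>x. f x y))"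

text \<open>\<open>signed \<alpha> \<beta> v\<close> is \<open>(-1)\<close> to the power \<open>\<alpha>\<beta>\<close>, times \<open>v\<close>.\<close>

definition signed :: "bit \<Rightarrow> bit \<Rightarrow> 'v::ab_group_add \<Rightarrow> 'v" where
  "signed \<alpha> \<beta> v = (if \<alpha> * \<beta> = 1 then - v else v)"

definition leibniz_superalgebra ::
    "('k::field, 'l::ab_group_add, 'z) superalgebra_scheme \<Rightarrow> bool" where
  "leibniz_superalgebra L \<longleftrightarrow>
     superspace L \<and>
     bilinear_map (scl L) (scl L) (scl L) (brk L) \<and>
     (\<forall>\<alpha> \<beta>. \<forall>a\<in>part L \<alpha>. \<forall>b\<in>part L \<beta>. brk L a b \<in> part L (\<alpha> + \<beta>)) \<and>
     (\<forall>\<alpha> \<beta> \<gamma>. \<forall>a\<in>part L \<alpha>. \<forall>b\<in>part L \<beta>. \<forall>c\<in>part L \<gamma>.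
        brk L (brk L a b) c = brk L a (brk L b c) - signed \<alpha> \<beta> (brk L b (brk L a c)))"

definition leibniz_hom ::
    "('k::field, 'a::ab_group_add, 'y) superalgebra_scheme \<Rightarrow>
     ('k, 'b::ab_group_add, 'z) superalgebra_scheme \<Rightarrow> ('a \<Rightarrow> 'b) \<Rightarrow> bool" where
  "leibniz_hom A B f \<longleftrightarrow>
     Vector_Spaces.linear (scl A) (scl B) f \<and>
     (\<forall>\<alpha>. \<forall>x\<in>part A \<alpha>. f x \<in> part B \<alpha>) \<and>
     (\<forall>x y. f (brk A x y) = brk B (f x) (f y))"

definition leibniz_module ::
    "('k::field, 'l::ab_group_add, 'y) superalgebra_scheme \<Rightarrow>
     ('k, 'l, 'm::ab_group_add, 'z) supermodule_scheme \<Rightarrow> bool" where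
  "leibniz_module L M \<longleftrightarrow>
     superspace M \<and>
     bilinear_map (scl L) (scl M) (scl M) (lact M) \<and>
     bilinear_map (scl M) (scl L) (scl M) (ract M) \<and>
     (\<forall>\<alpha> \<beta>. \<forall>a\<in>part L \<alpha>. \<forall>m\<in>part M \<beta>. lact M a m \<in> part M (\<alpha> + \<beta>)) \<and>
     (\<forall>\<alpha> \<beta>. \<forall>a\<in>part L \<alpha>. \<forall>m\<in>part M \<beta>. ract M m a \<in> part M (\<beta> + \<alpha>)) \<and>
     (\<forall>\<alpha> \<beta> \<mu>. \<forall>a\<in>part L \<alpha>. \<forall>b\<in>part L \<beta>. \<forall>m\<in>part M \<mu>.
        lact M (brk L a b) m = lact M a (lact M b m) - signed \<alpha> \<beta> (lact M b (lact M a m)) \<and>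
        ract M (lact M a m) b = lact M a (ract M m b) - signed \<alpha> \<mu> (ract M m (brk L a b)) \<and>
        ract M (ract M m a) b = ract M m (brk L a b) - signed \<mu> \<alpha> (lact M a (ract M m b)))"

definition cochains1 ::
    "('k::field, 'l::ab_group_add, 'y) superalgebra_scheme \<Rightarrow>
     ('k, 'l, 'm::ab_group_add, 'z) supermodule_scheme \<Rightarrow> ('l \<Rightarrow> 'm) set" where
  "cochains1 L M =
     {f. Vector_Spaces.linear (scl L) (scl M) f \<and>
         (\<forall>\<alpha>. \<forall>x\<in>part L \<alpha>. f x \<in> part M \<alpha>)}"

definition cochains2 ::
    "('k::field, 'l::ab_group_add, 'y) superalgebra_scheme \<Rightarrow>
     ('k, 'l, 'm::ab_group_add, 'z) supermodule_scheme \<Rightarrow> ('l \<Rightarrow> 'l \<Rightarrow> 'm) set" where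
  "cochains2 L M =
     {g. bilinear_map (scl L) (scl L) (scl M) g \<and>
         (\<forall>\<alpha> \<beta>. \<forall>x\<in>part L \<alpha>. \<forall>y\<in>part L \<beta>. g x y \<in> part M (\<alpha> + \<beta>))}"

definition delta1 ::
    "('k::field, 'l::ab_group_add, 'y) superalgebra_scheme \<Rightarrow>
     ('k, 'l, 'm::ab_group_add, 'z) supermodule_scheme \<Rightarrow> ('l \<Rightarrow> 'm) \<Rightarrow> 'l \<Rightarrow> 'l \<Rightarrow> 'm" where
  "delta1 L M f x1 x2 = - f (brk L x1 x2) + lact M x1 (f x2) + ract M (f x1) x2"

text \<open>
  The value of the coboundary on \<open>x1\<close> of degree \<open>\<alpha>\<close>, \<open>x2\<close> of degree \<open>\<beta>\<close>, and homogeneous \<open>x3\<close>,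
  whose degree does not enter. Being trilinear, the coboundary vanishes iff it does on all
  homogeneous arguments.
\<close>

definition delta2 ::
    "('k::field, 'l::ab_group_add, 'y) superalgebra_scheme \<Rightarrow>
     ('k, 'l, 'm::ab_group_add, 'z) supermodule_scheme \<Rightarrow> ('l \<Rightarrow> 'l \<Rightarrow> 'm) \<Rightarrow>
     bit \<Rightarrow> bit \<Rightarrow> 'l \<Rightarrow> 'l \<Rightarrow> 'l \<Rightarrow> 'm" where
  "delta2 L M g \<alpha> \<beta> x1 x2 x3 =
     - g (brk L x1 x2) x3 - signed \<alpha> \<beta> (g x2 (brk L x1 x3)) + g x1 (brk L x2 x3)
     + lact M x1 (g x2 x3) - signed \<alpha> \<beta> (lact M x2 (g x1 x3)) - ract M (g x1 x2) x3"

definition cocycles2 ::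
    "('k::field, 'l::ab_group_add, 'y) superalgebra_scheme \<Rightarrow>
     ('k, 'l, 'm::ab_group_add, 'z) supermodule_scheme \<Rightarrow> ('l \<Rightarrow> 'l \<Rightarrow> 'm) set" where
  "cocycles2 L M =
     {g \<in> cochains2 L M.
        \<forall>\<alpha> \<beta> \<gamma>. \<forall>x1\<in>part L \<alpha>. \<forall>x2\<in>part L \<beta>. \<forall>x3\<in>part L \<gamma>. delta2 L M g \<alpha> \<beta> x1 x2 x3 = 0}"

definition coboundaries2 ::
    "('k::field, 'l::ab_group_add, 'y) superalgebra_scheme \<Rightarrow>
     ('k, 'l, 'm::ab_group_add, 'z) supermodule_scheme \<Rightarrow> ('l \<Rightarrow> 'l \<Rightarrow> 'm) set" where
  "coboundaries2 L M = delta1 L M ` cochains1 L M"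

definition cohomologous ::
    "('k::field, 'l::ab_group_add, 'y) superalgebra_scheme \<Rightarrow>
     ('k, 'l, 'm::ab_group_add, 'z) supermodule_scheme \<Rightarrow>
     (('l \<Rightarrow> 'l \<Rightarrow> 'm) \<times> ('l \<Rightarrow> 'l \<Rightarrow> 'm)) set" where
  "cohomologous L M =
     {(g, h). g \<in> cocycles2 L M \<and> h \<in> cocycles2 L M \<and>
              (\<lambda>x y. g x y - h x y) \<in> coboundaries2 L M}"

definition cohomology2 ::
    "('k::field, 'l::ab_group_add, 'y) superalgebra_scheme \<Rightarrow>
     ('k, 'l, 'm::ab_group_add, 'z) supermodule_scheme \<Rightarrow> ('l \<Rightarrow> 'l \<Rightarrow> 'm) set set" where
  "cohomology2 L M = cocycles2 L M // cohomologous L M"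

definition abelian_superalgebra ::
    "('k::field, 'm::ab_group_add, 'z) superspace_scheme \<Rightarrow> ('k, 'm) superalgebra" where
  "abelian_superalgebra M = \<lparr>scl = scl M, part = part M, brk = (\<lambda>_ _. 0)\<rparr>"

record ('k, 'l, 'm, 'e) extension =
  middle :: "('k, 'e) superalgebra"
  incl :: "'m \<Rightarrow> 'e"
  proj :: "'e \<Rightarrow> 'l"

definition is_extension ::
    "('k::field, 'l::ab_group_add, 'y) superalgebra_scheme \<Rightarrow>
     ('k, 'l, 'm::ab_group_add, 'z) supermodule_scheme \<Rightarrow>
     ('k, 'l, 'm, 'e::ab_group_add) extension \<Rightarrow> bool" where
  "is_extension L M X \<longleftrightarrow>
     leibniz_superalgebra (middle X) \<and>
     leibniz_hom (abelian_superalgebra M) (middle X) (incl X) \<and>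
     leibniz_hom (middle X) L (proj X) \<and>
     inj (incl X) \<and> range (incl X) = {x. proj X x = 0} \<and> surj (proj X) \<and>
     (\<forall>x m. brk (middle X) x (incl X m) = incl X (lact M (proj X x) m) \<and>
            brk (middle X) (incl X m) x = incl X (ract M m (proj X x)))"

text \<open>The carriers of the two extensions may have different types.\<close>

definition ext_equivalent ::
    "('k::field, 'l, 'm, 'e::ab_group_add) extension \<Rightarrow>
     ('k, 'l, 'm, 'f::ab_group_add) extension \<Rightarrow> bool" where
  "ext_equivalent X Y \<longleftrightarrow>
     (\<exists>\<psi>. leibniz_hom (middle X) (middle Y) \<psi> \<and> bij \<psi> \<and>
          (\<forall>m. \<psi> (incl X m) = incl Y m) \<and> (\<forall>x. proj Y (\<psi> x) = proj X x))"

text \<open>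
  A set of extensions needs a fixed carrier type, and every extension is equivalent to one
  carried by \<^typ>\<open>'l \<times> 'm\<close>, the additive group of L + M. The set of equivalence classes is
  therefore formed over this type.
\<close>

definition ext_rel ::
    "('k::field, 'l::ab_group_add, 'y) superalgebra_scheme \<Rightarrow>
     ('k, 'l, 'm::ab_group_add, 'z) supermodule_scheme \<Rightarrow>
     (('k, 'l, 'm, 'l \<times> 'm) extension \<times> ('k, 'l, 'm, 'l \<times> 'm) extension) set" where
  "ext_rel L M = {(X, Y). is_extension L M X \<and> is_extension L M Y \<and> ext_equivalent X Y}"

definition ext_classes ::
    "('k::field, 'l::ab_group_add, 'y) superalgebra_scheme \<Rightarrow>
     ('k, 'l, 'm::ab_group_add, 'z) supermodule_scheme \<Rightarrow>
     ('k, 'l, 'm, 'l \<times> 'm) extension set set" where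
  "ext_classes L M = {X. is_extension L M X} // ext_rel L M"

definition cocycle_extension ::
    "('k::field, 'l::ab_group_add, 'y) superalgebra_scheme \<Rightarrow>
     ('k, 'l, 'm::ab_group_add, 'z) supermodule_scheme \<Rightarrow> ('l \<Rightarrow> 'l \<Rightarrow> 'm) \<Rightarrow>
     ('k, 'l, 'm, 'l \<times> 'm) extension" where
  "cocycle_extension L M h =
     \<lparr>middle =
        \<lparr>scl = (\<lambda>c (x, m). (scl L c x, scl M c m)),
         part = (\<lambda>\<alpha>. part L \<alpha> \<times> part M \<alpha>),
         brk = (\<lambda>(x, m) (y, n). (brk L x y, lact M x n + ract M m y + h x y))\<rparr>,
      incl = (\<lambda>m. (0, m)),
      proj = (\<lambda>(x, m). x)\<rparr>"

end

theory Submission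
  imports Defs
begin

text \<open>
  An extension of \<open>L\<close> by \<open>M\<close> is, as a graded vector space, a direct sum, because over a field the
  projection has a linear section \<open>s\<close> of degree 0 (\<open>graded_section\<close>). The module structure on \<open>M\<close>
  prescribes every bracket except those between elements of \<open>s L\<close>, and these are determined by the
  bilinear map \<open>h\<close> with \<open>i (h x y) = [s x, s y] - s [x, y]\<close>. So every extension is equivalent
  to \<open>L \<times> M\<close> with the bracket twisted by some 2-cochain \<open>h\<close>.

  Which \<open>h\<close> occur is decided by one computation (\<open>leibniz_defect\<close>): for homogeneous arguments, the
  two sides of the Leibniz identity in the twisted bracket differ by the coboundary of \<open>h\<close> and
  nothing else, the remaining terms cancelling by the axioms of \<open>L\<close> and \<open>M\<close>. Hence the twisted
  bracket is a Leibniz bracket iff \<open>h\<close> is a cocycle. Read in one direction this makes every cocycle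
  an extension; read in the other it shows that the \<open>h\<close> obtained from an extension is a cocycle,
  since the Leibniz identity can be transported to \<open>L \<times> M\<close>
  (\<open>extension_equivalent_to_cocycle_extension\<close>).

  A linear map between two such extensions that respects inclusions and projections must be a shear
  \<open>(x, m) \<mapsto> (x, f x + m)\<close>. Comparing brackets, it is a homomorphism from the extension of \<open>g\<close> to
  that of \<open>h\<close> iff \<open>g - h = \<delta>\<^sup>1 f\<close> (\<open>ext_equivalent_iff_coboundary\<close>). So being cohomologous is
  equivalence of extensions pulled back along \<open>h \<mapsto> E\<^sub>h\<close>, a map that meets every equivalence class, and
  it therefore induces a bijection of the quotients (\<open>bij_betw_quotients\<close>).
\<close>

section \<open>Quotients by pulled back equivalence relations\<close>

lemma equiv_pullback:
  assumes "equiv B s" and "\<And>x. x \<in> A \<Longrightarrow> f x \<in> B"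
  shows "equiv A {(x, y). x \<in> A \<and> y \<in> A \<and> (f x, f y) \<in> s}"
proof -
  have "refl_on B s" "sym s" "trans s" using assms(1) by (simp_all add: equiv_def)
  note refl = refl_onD[OF this(1)] and sym = symD[OF this(2)] and trans = transD[OF this(3)]
  show ?thesis
  proof (rule equivI)
    show "refl_on A {(x, y). x \<in> A \<and> y \<in> A \<and> (f x, f y) \<in> s}"
      using refl assms(2) by (simp add: refl_on_def)
    show "sym {(x, y). x \<in> A \<and> y \<in> A \<and> (f x, f y) \<in> s}"
      using sym by (simp add: sym_def)
    show "trans {(x, y). x \<in> A \<and> y \<in> A \<and> (f x, f y) \<in> s}"
      unfolding trans_def using trans by blast
  qed auto
qed

text \<open>
  The saturation \<open>s `` (f ` C)\<close> of the image of a class \<open>C\<close> is again a class, which defines \<open>\<omega>\<close>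
  without a choice of representatives.
\<close>

lemma bij_betw_quotients:
  assumes r: "equiv A r" and s: "equiv B s" and f: "\<And>x. x \<in> A \<Longrightarrow> f x \<in> B"
    and iff: "\<And>x y. x \<in> A \<Longrightarrow> y \<in> A \<Longrightarrow> (x, y) \<in> r \<longleftrightarrow> (f x, f y) \<in> s"
    and ess_surj: "\<And>y. y \<in> B \<Longrightarrow> \<exists>x\<in>A. (f x, y) \<in> s"
  shows "\<exists>\<omega>. bij_betw \<omega> (A // r) (B // s) \<and> (\<forall>x\<in>A. \<omega> (r `` {x}) = s `` {f x})"
proof -
  define \<omega> where "\<omega> C = s `` (f ` C)" for C
  have \<omega>: "\<omega> (r `` {x}) = s `` {f x}" if x: "x \<in> A" for x
  proof -
    have "s `` {f y} = s `` {f x}" if "y \<in> r `` {x}" for y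
    proof -
      have "(x, y) \<in> r" "y \<in> A" using that equiv_type[OF r] by auto
      then have "(f x, f y) \<in> s" using x iff by blast
      then show ?thesis by (rule equiv_class_eq[OF s, symmetric])
    qed
    moreover have "x \<in> r `` {x}" using equiv_class_self[OF r x] .
    ultimately show ?thesis unfolding \<omega>_def by blast
  qed
  have "bij_betw \<omega> (A // r) (B // s)"
    unfolding bij_betw_def
  proof
    show "inj_on \<omega> (A // r)"
    proof (rule inj_onI)
      fix C D assume "C \<in> A // r" "D \<in> A // r" and eq: "\<omega> C = \<omega> D"
      then obtain x y where xy: "x \<in> A" "C = r `` {x}" "y \<in> A" "D = r `` {y}"
        by (auto elim!: quotientE)
      then have "(f x, f y) \<in> s" using eq eq_equiv_class_iff[OF s f f] by (simp add: \<omega>)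
      then have "(x, y) \<in> r" using iff xy by simp
      then show "C = D" unfolding xy by (rule equiv_class_eq[OF r])
    qed
    show "\<omega> ` (A // r) = B // s"
    proof
      show "\<omega> ` (A // r) \<subseteq> B // s"
      proof
        fix D assume "D \<in> \<omega> ` (A // r)"
        then obtain x where "x \<in> A" "D = \<omega> (r `` {x})" by (auto elim!: quotientE)
        then show "D \<in> B // s" using \<omega> quotientI[OF f] by simp
      qed
      show "B // s \<subseteq> \<omega> ` (A // r)"
      proof
        fix D assume "D \<in> B // s"
        then obtain y where y: "y \<in> B" "D = s `` {y}" by (auto elim!: quotientE)
        then obtain x where x: "x \<in> A" "(f x, y) \<in> s" using ess_surj by blast
        then have "D = \<omega> (r `` {x})" by (simp add: y(2) \<omega> equiv_class_eq[OF s x(2)])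
        then show "D \<in> \<omega> ` (A // r)" using quotientI[OF x(1)] by (rule image_eqI)
      qed
    qed
  qed
  then show ?thesis using \<omega> by blast
qed

section \<open>Linear maps and gradings\<close>

lemma linear_map_simps:
  assumes "Vector_Spaces.linear s1 s2 f"
  shows "f (x + y) = f x + f y" "f (s1 c x) = s2 c (f x)" "f 0 = 0" "f (- x) = - f x"
    "f (x - y) = f x - f y"
proof -
  interpret Vector_Spaces.linear s1 s2 f by fact
  show "f (x + y) = f x + f y" "f (s1 c x) = s2 c (f x)" "f 0 = 0" "f (- x) = - f x"
    "f (x - y) = f x - f y"
    by (simp_all add: add scale zero neg diff)
qed

lemma linear_imp_additive: "Vector_Spaces.linear s1 s2 f \<Longrightarrow> Modules.additive f"
  by (simp add: Modules.additive_def linear_map_simps)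

lemma bilinear_map_simps:
  assumes "bilinear_map s1 s2 s3 f"
  shows "f (x + x') y = f x y + f x' y" "f (s1 c x) y = s3 c (f x y)" "f 0 y = 0"
    "f (- x) y = - f x y" "f (x - x') y = f x y - f x' y"
    "f x (y + y') = f x y + f x y'" "f x (s2 c y) = s3 c (f x y)" "f x 0 = 0"
    "f x (- y) = - f x y" "f x (y - y') = f x y - f x y'"
proof -
  have l: "Vector_Spaces.linear s1 s3 (\<lambda>x. f x y)" and r: "Vector_Spaces.linear s2 s3 (f x)" for x y
    using assms by (auto simp: bilinear_map_def)
  show "f (x + x') y = f x y + f x' y" "f (s1 c x) y = s3 c (f x y)" "f 0 y = 0"
    "f (- x) y = - f x y" "f (x - x') y = f x y - f x' y"
    using linear_map_simps[OF l] by blast+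
  show "f x (y + y') = f x y + f x y'" "f x (s2 c y) = s3 c (f x y)" "f x 0 = 0"
    "f x (- y) = - f x y" "f x (y - y') = f x y - f x y'"
    using linear_map_simps[OF r] by blast+
qed

lemma bilinear_mapI:
  assumes "vector_space s1" "vector_space s2" "vector_space s3"
    and "\<And>x x' y. f (x + x') y = f x y + f x' y" "\<And>c x y. f (s1 c x) y = s3 c (f x y)"
    and "\<And>x y y'. f x (y + y') = f x y + f x y'" "\<And>c x y. f x (s2 c y) = s3 c (f x y)"
  shows "bilinear_map s1 s2 s3 f"
  using assms by (simp add: bilinear_map_def Vector_Spaces.linear_iff)

lemma signed_map: "Vector_Spaces.linear s1 s2 f \<Longrightarrow> f (signed \<alpha> \<beta> v) = signed \<alpha> \<beta> (f v)"
  by (simp add: signed_def linear_map_simps)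

lemma signed_add: "signed \<alpha> \<beta> (v + w) = signed \<alpha> \<beta> v + signed \<alpha> \<beta> w"
  by (simp add: signed_def)

lemma signed_Pair: "signed \<alpha> \<beta> (v, w) = (signed \<alpha> \<beta> v, signed \<alpha> \<beta> w)"
  by (simp add: signed_def)

lemma superspace_simps:
  assumes "superspace V"
  shows "vector_space (scl V)" "scl V c (v + w) = scl V c v + scl V c w"
    "scl V (c + d) v = scl V c v + scl V d v" "scl V c (scl V d v) = scl V (c * d) v" "scl V 1 v = v"
    "scl V c 0 = 0" "scl V c (v - w) = scl V c v - scl V c w"
proof -
  show "vector_space (scl V)" using assms by (simp add: superspace_def)
  then interpret vector_space "scl V" .
  show "scl V c (v + w) = scl V c v + scl V c w"
    "scl V (c + d) v = scl V c v + scl V d v" "scl V c (scl V d v) = scl V (c * d) v" "scl V 1 v = v"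
    "scl V c 0 = 0" "scl V c (v - w) = scl V c v - scl V c w"
    by (simp_all add: scale_right_distrib scale_left_distrib scale_right_diff_distrib)
qed

lemma superspace_closed:
  assumes "superspace V"
  shows "0 \<in> part V \<alpha>" "v \<in> part V \<alpha> \<Longrightarrow> w \<in> part V \<alpha> \<Longrightarrow> v + w \<in> part V \<alpha>"
    "v \<in> part V \<alpha> \<Longrightarrow> scl V c v \<in> part V \<alpha>"
    "v \<in> part V \<alpha> \<Longrightarrow> - v \<in> part V \<alpha>" "v \<in> part V \<alpha> \<Longrightarrow> w \<in> part V \<alpha> \<Longrightarrow> v - w \<in> part V \<alpha>"
proof -
  interpret vector_space "scl V" by (rule superspace_simps[OF assms])
  have s: "subspace (part V \<alpha>)" using assms by (auto simp: superspace_def)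
  show "0 \<in> part V \<alpha>" "v \<in> part V \<alpha> \<Longrightarrow> w \<in> part V \<alpha> \<Longrightarrow> v + w \<in> part V \<alpha>"
    "v \<in> part V \<alpha> \<Longrightarrow> scl V c v \<in> part V \<alpha>"
    "v \<in> part V \<alpha> \<Longrightarrow> - v \<in> part V \<alpha>" "v \<in> part V \<alpha> \<Longrightarrow> w \<in> part V \<alpha> \<Longrightarrow> v - w \<in> part V \<alpha>"
    by (simp_all add: subspace_0[OF s] subspace_add[OF s] subspace_scale[OF s] subspace_neg[OF s]
        subspace_diff[OF s])
qed

lemma superspace_decompose:
  assumes "superspace V" "\<alpha> \<noteq> \<beta>"
  obtains a b where "a \<in> part V \<alpha>" "b \<in> part V \<beta>" "v = a + b"
proof -
  have "\<exists>a\<in>part V 0. \<exists>b\<in>part V 1. v = a + b"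
    using assms(1) unfolding superspace_def by blast
  then obtain a b where ab: "a \<in> part V 0" "b \<in> part V 1" "v = a + b" by blast
  show ?thesis
  proof (cases "\<alpha> = 0")
    case True
    then have "\<beta> = 1" using assms(2) by (cases \<beta>) simp_all
    then show ?thesis using that ab True by blast
  next
    case False
    then have 1: "\<alpha> = 1" by simp
    have "\<beta> = 0" using assms(2) 1 by (cases \<beta>) simp_all
    then show ?thesis using that[of b a] ab 1 by (simp add: add.commute)
  qed
qed

lemma superspace_disjoint:
  assumes "superspace V" "\<alpha> \<noteq> \<beta>" "v \<in> part V \<alpha>" "v \<in> part V \<beta>"
  shows "v = 0"
proof -
  have "part V 0 \<inter> part V 1 = {0}" using assms by (auto simp: superspace_def)
  then show ?thesis using assms(2-) by (cases \<alpha>; cases \<beta>) auto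
qed

text \<open>
  Split \<open>v\<close> into components: the one of the wrong degree is mapped into both parts of \<open>W\<close>, hence to
  \<open>0\<close>. For injective \<open>f\<close> this says that \<open>f\<close> reflects degrees, for surjective \<open>f\<close> that homogeneous
  elements have homogeneous preimages.
\<close>

lemma homogeneous_preimage:
  assumes V: "superspace V" and W: "superspace W" and f: "Vector_Spaces.linear (scl V) (scl W) f"
    and deg: "\<And>\<alpha> x. x \<in> part V \<alpha> \<Longrightarrow> f x \<in> part W \<alpha>" and fv: "f v \<in> part W \<alpha>"
  obtains a where "a \<in> part V \<alpha>" "f a = f v"
proof -
  have "\<alpha> \<noteq> \<alpha> + 1" by simp
  then obtain a b where ab: "a \<in> part V \<alpha>" "b \<in> part V (\<alpha> + 1)" "v = a + b"
    using superspace_decompose[OF V] by metis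
  have "f b = f v - f a" using ab(3) linear_map_simps[OF f] by simp
  then have "f b \<in> part W \<alpha>" using fv deg[OF ab(1)] superspace_closed[OF W] by simp
  then have "f b = 0" using superspace_disjoint[OF W \<open>\<alpha> \<noteq> \<alpha> + 1\<close>] deg[OF ab(2)] by blast
  then show ?thesis using that[OF ab(1)] ab(3) linear_map_simps[OF f] by simp
qed

lemma linear_cancel_inj:
  assumes i: "Vector_Spaces.linear s2 s3 i" "inj i" and f: "Vector_Spaces.linear s1 s3 (\<lambda>x. i (f x))"
  shows "Vector_Spaces.linear s1 s2 f"
  unfolding Vector_Spaces.linear_iff
proof (intro conjI allI)
  show "vector_space s1" "vector_space s2" using i f by (auto simp: Vector_Spaces.linear_iff)
  show "f (x + y) = f x + f y" for x y
    using linear_map_simps(1)[OF i(1)] linear_map_simps(1)[OF f] by (metis injD[OF i(2)])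
  show "f (s1 c x) = s2 c (f x)" for c x
    using linear_map_simps(2)[OF i(1)] linear_map_simps(2)[OF f] by (metis injD[OF i(2)])
qed

text \<open>Linearity of the components follows from the uniqueness of the decomposition.\<close>

lemma graded_projections:
  assumes V: "superspace V"
  obtains p q where "Vector_Spaces.linear (scl V) (scl V) p" "Vector_Spaces.linear (scl V) (scl V) q"
    "\<And>v. p v \<in> part V 0" "\<And>v. q v \<in> part V 1" "\<And>v. p v + q v = v"
proof -
  have "\<exists>a b. a \<in> part V 0 \<and> b \<in> part V 1 \<and> a + b = v" for v
    using superspace_decompose[OF V zero_neq_one, of v] by blast
  then obtain p q where p: "\<And>v. p v \<in> part V 0" and q: "\<And>v. q v \<in> part V 1"
    and pq: "\<And>v. p v + q v = v"
    by metis
  have uniq: "p v = a \<and> q v = b" if "a \<in> part V 0" "b \<in> part V 1" "v = a + b" for v a b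
  proof -
    have eq: "p v - a = b - q v" using pq[of v] that(3) by (simp add: algebra_simps)
    have "p v - a \<in> part V 0" "b - q v \<in> part V 1"
      using p[of v] q[of v] that superspace_closed[OF V] by auto
    then have "p v - a = 0" using superspace_disjoint[OF V zero_neq_one] eq by metis
    then show ?thesis using eq by simp
  qed
  have add: "p (v + w) = p v + p w \<and> q (v + w) = q v + q w" for v w
  proof (rule uniq)
    show "v + w = p v + p w + (q v + q w)"
      by (subst pq[of v, symmetric], subst pq[of w, symmetric]) (simp only: add.assoc add.left_commute)
  qed (use p q superspace_closed[OF V] in auto)
  have scl: "p (scl V c v) = scl V c (p v) \<and> q (scl V c v) = scl V c (q v)" for c v
  proof (rule uniq)
    show "scl V c v = scl V c (p v) + scl V c (q v)"
      by (simp only: pq flip: superspace_simps(2)[OF V])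
  qed (use p q superspace_closed[OF V] in auto)
  show ?thesis
    using that[of p q] p q pq add scl superspace_simps(1)[OF V] by (simp add: Vector_Spaces.linear_iff)
qed

text \<open>
  Linear algebra splits \<open>f\<close> over each of the two parts, because \<open>f\<close> maps \<open>V\<^sub>\<alpha>\<close> onto \<open>W\<^sub>\<alpha>\<close>; the two
  splittings are glued along the decomposition of \<open>W\<close>.
\<close>

lemma graded_section:
  assumes V: "superspace V" and W: "superspace W" and f: "Vector_Spaces.linear (scl V) (scl W) f"
    and deg: "\<And>\<alpha> x. x \<in> part V \<alpha> \<Longrightarrow> f x \<in> part W \<alpha>" and surj: "surj f"
  obtains s where "Vector_Spaces.linear (scl W) (scl V) s" "\<And>w. f (s w) = w"
    "\<And>\<alpha> w. w \<in> part W \<alpha> \<Longrightarrow> s w \<in> part V \<alpha>"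
proof -
  interpret vector_space_pair "scl V" "scl W"
    using superspace_simps(1)[OF V] superspace_simps(1)[OF W] by (simp add: vector_space_pair_def)
  have "\<exists>g. g ` UNIV \<subseteq> part V \<alpha> \<and> Vector_Spaces.linear (scl W) (scl V) g \<and>
          (\<forall>w\<in>f ` part V \<alpha>. f (g w) = w)" for \<alpha>
    using V by (intro linear_exists_right_inverse_on[OF f]) (auto simp: superspace_def)
  then obtain g where gV: "\<And>\<alpha> w. g \<alpha> w \<in> part V \<alpha>"
    and g: "\<And>\<alpha>. Vector_Spaces.linear (scl W) (scl V) (g \<alpha>)"
    and fg: "\<And>\<alpha> w. w \<in> f ` part V \<alpha> \<Longrightarrow> f (g \<alpha> w) = w"
    by (metis image_subset_iff UNIV_I)
  have "w \<in> f ` part V \<alpha>" if "w \<in> part W \<alpha>" for w \<alpha>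
    using that surj homogeneous_preimage[OF V W f deg] by (metis imageI surjD)
  then have fg: "f (g \<alpha> w) = w" if "w \<in> part W \<alpha>" for w \<alpha> using that fg by blast
  obtain p q where p: "Vector_Spaces.linear (scl W) (scl W) p"
    and q: "Vector_Spaces.linear (scl W) (scl W) q"
    and pW: "\<And>w. p w \<in> part W 0" and qW: "\<And>w. q w \<in> part W 1" and pq: "\<And>w. p w + q w = w"
    using graded_projections[OF W] by metis
  define s where "s w = g 0 (p w) + g 1 (q w)" for w
  have fs: "f (s w) = w" for w
    using fg pW qW pq linear_map_simps[OF f] by (simp add: s_def)
  have lin: "Vector_Spaces.linear (scl W) (scl V) s"
    using superspace_simps(1,2)[OF V] superspace_simps(1)[OF W]
    by (simp add: Vector_Spaces.linear_iff s_def linear_map_simps[OF g] linear_map_simps[OF p]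
        linear_map_simps[OF q] algebra_simps)
  have sdeg: "s w \<in> part V \<alpha>" if w: "w \<in> part W \<alpha>" for w \<alpha>
  proof (cases "\<alpha> = 0")
    case True
    have "q w = w - p w" using pq[of w] by (simp add: eq_diff_eq add.commute)
    then have "q w \<in> part W 0" using w True pW superspace_closed[OF W] by auto
    then have "q w = 0" using qW superspace_disjoint[OF W, of 0 1] by auto
    then show ?thesis using True gV[of 0] by (simp add: s_def linear_map_simps[OF g])
  next
    case False
    then have 1: "\<alpha> = 1" by simp
    have "p w = w - q w" using pq[of w] by (simp add: eq_diff_eq)
    then have "p w \<in> part W 1" using w 1 qW superspace_closed[OF W] by auto
    then have "p w = 0" using pW superspace_disjoint[OF W, of 0 1] by auto
    then show ?thesis using 1 gV[of 1] by (simp add: s_def linear_map_simps[OF g])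
  qed
  show ?thesis using that[OF lin fs sdeg] .
qed

section \<open>Equivalence of extensions\<close>

lemma leibniz_homD:
  assumes "leibniz_hom A B f"
  shows "Vector_Spaces.linear (scl A) (scl B) f" "x \<in> part A \<alpha> \<Longrightarrow> f x \<in> part B \<alpha>"
    "f (brk A x y) = brk B (f x) (f y)"
  using assms by (auto simp: leibniz_hom_def)

lemma leibniz_hom_id: "superspace A \<Longrightarrow> leibniz_hom A A id"
  by (simp add: leibniz_hom_def Vector_Spaces.linear_iff superspace_simps(1))

lemma leibniz_hom_compose: "leibniz_hom A B f \<Longrightarrow> leibniz_hom B C g \<Longrightarrow> leibniz_hom A C (g \<circ> f)"
  by (simp add: leibniz_hom_def Vector_Spaces.linear_iff)

text \<open>The inverse has degree 0 because a bijective \<open>f\<close> reflects degrees.\<close>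

lemma leibniz_hom_inv:
  assumes A: "superspace A" and B: "superspace B" and f: "leibniz_hom A B f" and bij: "bij f"
  shows "leibniz_hom B A (inv f)"
  unfolding leibniz_hom_def
proof (intro conjI allI ballI)
  note lin = leibniz_homD(1)[OF f]
  have inv_eq: "inv f y = x" if "f x = y" for x y
    using that bij by (auto simp: bij_def)
  have f_inv: "f (inv f y) = y" for y
    using bij by (simp add: bij_is_surj surj_f_inv_f)
  show "Vector_Spaces.linear (scl B) (scl A) (inv f)"
    unfolding Vector_Spaces.linear_iff
  proof (intro conjI allI)
    show "inv f (x + y) = inv f x + inv f y" for x y
      by (rule inv_eq) (simp add: linear_map_simps[OF lin] f_inv)
    show "inv f (scl B c x) = scl A c (inv f x)" for c x
      by (rule inv_eq) (simp add: linear_map_simps[OF lin] f_inv)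
  qed (simp_all add: superspace_simps(1)[OF A] superspace_simps(1)[OF B])
  show "inv f y \<in> part A \<alpha>" if "y \<in> part B \<alpha>" for \<alpha> y
  proof -
    have "f (inv f y) \<in> part B \<alpha>" using that by (simp add: f_inv)
    then obtain a where "a \<in> part A \<alpha>" "f a = f (inv f y)"
      using homogeneous_preimage[OF A B lin leibniz_homD(2)[OF f]] by blast
    then show ?thesis using inv_eq f_inv by metis
  qed
  show "inv f (brk B x y) = brk A (inv f x) (inv f y)" for x y
    by (rule inv_eq) (simp add: leibniz_homD(3)[OF f] f_inv)
qed

lemma is_extension_superspace: "is_extension L M X \<Longrightarrow> superspace (middle X)"
  by (simp add: is_extension_def leibniz_superalgebra_def)

lemma ext_equivalent_refl: "is_extension L M X \<Longrightarrow> ext_equivalent X X"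
  unfolding ext_equivalent_def by (intro exI[of _ id]) (simp add: leibniz_hom_id is_extension_superspace)

lemma ext_equivalent_sym:
  assumes "is_extension L M X" "is_extension L M Y" "ext_equivalent X Y"
  shows "ext_equivalent Y X"
proof -
  obtain \<psi> where \<psi>: "leibniz_hom (middle X) (middle Y) \<psi>" "bij \<psi>" "\<And>m. \<psi> (incl X m) = incl Y m"
    "\<And>x. proj Y (\<psi> x) = proj X x"
    using assms(3) by (auto simp: ext_equivalent_def)
  have "inv \<psi> (incl Y m) = incl X m" for m
    using \<psi>(2,3) by (metis bij_inv_eq_iff)
  moreover have "proj X (inv \<psi> y) = proj Y y" for y
    using \<psi>(2,4) by (metis bij_inv_eq_iff)
  ultimately show ?thesis
    using leibniz_hom_inv[OF assms(1,2)[THEN is_extension_superspace] \<psi>(1,2)] bij_imp_bij_inv[OF \<psi>(2)]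
    by (auto simp: ext_equivalent_def)
qed

lemma ext_equivalent_trans:
  assumes "ext_equivalent X Y" "ext_equivalent Y Z"
  shows "ext_equivalent X Z"
proof -
  obtain \<phi> \<psi> where "leibniz_hom (middle X) (middle Y) \<phi>" "bij \<phi>"
    "\<forall>m. \<phi> (incl X m) = incl Y m" "\<forall>x. proj Y (\<phi> x) = proj X x"
    "leibniz_hom (middle Y) (middle Z) \<psi>" "bij \<psi>"
    "\<forall>m. \<psi> (incl Y m) = incl Z m" "\<forall>x. proj Z (\<psi> x) = proj Y x"
    using assms by (auto simp: ext_equivalent_def)
  then show ?thesis
    unfolding ext_equivalent_def
    by (intro exI[of _ "\<psi> \<circ> \<phi>"]) (auto intro: leibniz_hom_compose bij_comp)
qed

lemma equiv_ext_rel: "equiv {X. is_extension L M X} (ext_rel L M)"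
proof (rule equivI)
  show "sym (ext_rel L M)"
    by (auto simp: sym_def ext_rel_def intro: ext_equivalent_sym)
  show "trans (ext_rel L M)"
    by (auto simp: trans_def ext_rel_def intro: ext_equivalent_trans)
qed (auto simp: refl_on_def ext_rel_def intro: ext_equivalent_refl)

lemma short_five_bij:
  fixes \<psi> :: "'a::ab_group_add \<Rightarrow> 'b::ab_group_add"
    and i :: "'m::ab_group_add \<Rightarrow> 'a" and i' :: "'m \<Rightarrow> 'b"
    and p :: "'a \<Rightarrow> 'l::ab_group_add" and p' :: "'b \<Rightarrow> 'l"
  assumes add: "Modules.additive \<psi>" "Modules.additive i" "Modules.additive i'"
      "Modules.additive p" "Modules.additive p'"
    and exact: "{x. p x = 0} = range i" "inj i'" "{y. p' y = 0} = range i'" "surj p"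
    and comm: "\<And>m. \<psi> (i m) = i' m" "\<And>x. p' (\<psi> x) = p x"
  shows "bij \<psi>"
proof (rule bijI)
  note diff = add[THEN additive.diff] and zero = add[THEN additive.zero]
  show "inj \<psi>"
  proof (rule injI)
    fix x y assume "\<psi> x = \<psi> y"
    then have 0: "\<psi> (x - y) = 0" by (simp add: diff)
    then have "p (x - y) = 0" using comm(2)[of "x - y"] by (simp add: zero)
    then obtain m where m: "x - y = i m" using exact(1) by blast
    then have "i' m = i' 0" using 0 comm(1) by (simp add: zero)
    then have "m = 0" using injD[OF exact(2)] by blast
    then show "x = y" using m by (simp add: zero)
  qed
  show "surj \<psi>"
  proof (unfold surj_def, intro allI)
    fix y
    obtain x where "p x = p' y" using exact(4) by (metis surjD)
    then have "p' (y - \<psi> x) = 0" by (simp add: diff comm)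
    then obtain m where "y - \<psi> x = i' m" using exact(3) by blast
    then have "\<psi> (x + i m) = y"
      using comm(1) by (simp add: additive.add[OF add(1)] algebra_simps)
    then show "\<exists>x. y = \<psi> x" by blast
  qed
qed

section \<open>The extension defined by a cochain\<close>

lemma cocycle_extension_simps [simp]:
  "scl (middle (cocycle_extension L M h)) c (x, m) = (scl L c x, scl M c m)"
  "part (middle (cocycle_extension L M h)) \<alpha> = part L \<alpha> \<times> part M \<alpha>"
  "brk (middle (cocycle_extension L M h)) (x, m) (y, n) = (brk L x y, lact M x n + ract M m y + h x y)"
  "incl (cocycle_extension L M h) m = (0, m)"
  "proj (cocycle_extension L M h) (x, m) = x"
  by (simp_all add: cocycle_extension_def)

locale leibniz_superalgebra_with_module =
  fixes L :: "('k::field, 'l::ab_group_add, 'y) superalgebra_scheme"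
    and M :: "('k, 'l, 'm::ab_group_add, 'z) supermodule_scheme"
  assumes leibniz: "leibniz_superalgebra L" and modl: "leibniz_module L M"
begin

abbreviation E :: "('l \<Rightarrow> 'l \<Rightarrow> 'm) \<Rightarrow> ('k, 'l \<times> 'm) superalgebra" where
  "E h \<equiv> middle (cocycle_extension L M h)"

lemma L_superspace: "superspace L" and M_superspace: "superspace M"
  using leibniz modl by (simp_all add: leibniz_superalgebra_def leibniz_module_def)

lemma brk_bilinear: "bilinear_map (scl L) (scl L) (scl L) (brk L)"
  and lact_bilinear: "bilinear_map (scl L) (scl M) (scl M) (lact M)"
  and ract_bilinear: "bilinear_map (scl M) (scl L) (scl M) (ract M)"
  using leibniz modl by (simp_all add: leibniz_superalgebra_def leibniz_module_def)

lemma cochains2_bilinear: "h \<in> cochains2 L M \<Longrightarrow> bilinear_map (scl L) (scl L) (scl M) h"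
  by (simp add: cochains2_def)

lemmas bilinear_simps = bilinear_map_simps[OF brk_bilinear] bilinear_map_simps[OF lact_bilinear]
  bilinear_map_simps[OF ract_bilinear]

lemma degree_closed:
  "a \<in> part L \<alpha> \<Longrightarrow> b \<in> part L \<beta> \<Longrightarrow> brk L a b \<in> part L (\<alpha> + \<beta>)"
  "a \<in> part L \<alpha> \<Longrightarrow> m \<in> part M \<beta> \<Longrightarrow> lact M a m \<in> part M (\<alpha> + \<beta>)"
  "a \<in> part L \<alpha> \<Longrightarrow> m \<in> part M \<beta> \<Longrightarrow> ract M m a \<in> part M (\<beta> + \<alpha>)"
  "h \<in> cochains2 L M \<Longrightarrow> a \<in> part L \<alpha> \<Longrightarrow> b \<in> part L \<beta> \<Longrightarrow> h a b \<in> part M (\<alpha> + \<beta>)"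
  using leibniz modl
  by (simp_all add: leibniz_superalgebra_def leibniz_module_def cochains2_def del: add_bit_eq_xor)

lemma leibniz_identities:
  assumes "a \<in> part L \<alpha>" "b \<in> part L \<beta>"
  shows "c \<in> part L \<gamma> \<Longrightarrow>
      brk L (brk L a b) c = brk L a (brk L b c) - signed \<alpha> \<beta> (brk L b (brk L a c))"
    and "m \<in> part M \<gamma> \<Longrightarrow>
      lact M (brk L a b) m = lact M a (lact M b m) - signed \<alpha> \<beta> (lact M b (lact M a m))"
    and "m \<in> part M \<gamma> \<Longrightarrow>
      ract M (lact M a m) b = lact M a (ract M m b) - signed \<alpha> \<gamma> (ract M m (brk L a b))"
    and "m \<in> part M \<gamma> \<Longrightarrow>
      ract M (ract M m a) b = ract M m (brk L a b) - signed \<gamma> \<alpha> (lact M a (ract M m b))"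
  using leibniz modl assms
  by (simp_all add: leibniz_superalgebra_def leibniz_module_def)

lemma cochain_extension_superspace: "superspace (E h)"
proof -
  note L = L_superspace and M = M_superspace
  have vs: "vector_space (scl (E h))"
    by unfold_locales
      (auto simp: superspace_simps[OF L] superspace_simps[OF M])
  show ?thesis
    unfolding superspace_def
  proof (intro conjI allI)
    show "module.subspace (scl (E h)) (part (E h) \<alpha>)" for \<alpha>
      using vs[folded module_iff_vector_space] superspace_closed[OF L] superspace_closed[OF M]
      by (auto simp: module.subspace_def zero_prod_def)
    show "part (E h) 0 \<inter> part (E h) 1 = {0}"
      using superspace_disjoint[OF L zero_neq_one] superspace_disjoint[OF M zero_neq_one]
        superspace_closed(1)[OF L] superspace_closed(1)[OF M]
      by (auto simp: zero_prod_def)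
    show "\<exists>a\<in>part (E h) 0. \<exists>b\<in>part (E h) 1. v = a + b" for v
    proof -
      obtain x m where v: "v = (x, m)" by force
      obtain a b where "a \<in> part L 0" "b \<in> part L 1" "x = a + b"
        using superspace_decompose[OF L zero_neq_one] .
      moreover obtain c d where "c \<in> part M 0" "d \<in> part M 1" "m = c + d"
        using superspace_decompose[OF M zero_neq_one] .
      ultimately show ?thesis
        by (intro bexI[of _ "(a, c)"] bexI[of _ "(b, d)"]) (simp_all add: v)
    qed
  qed (rule vs)
qed

lemma cochain_extension_bilinear:
  assumes "h \<in> cochains2 L M"
  shows "bilinear_map (scl (E h)) (scl (E h)) (scl (E h)) (brk (E h))"
  by (intro bilinear_mapI superspace_simps(1)[OF cochain_extension_superspace])
    (auto simp: bilinear_simps bilinear_map_simps[OF cochains2_bilinear[OF assms]]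
      superspace_simps[OF M_superspace] algebra_simps)

lemma cochain_extension_degree:
  assumes "h \<in> cochains2 L M" "u \<in> part (E h) \<alpha>" "v \<in> part (E h) \<beta>"
  shows "brk (E h) u v \<in> part (E h) (\<alpha> + \<beta>)"
proof -
  obtain x m y n where uv: "u = (x, m)" "v = (y, n)" by (metis surj_pair)
  then have hom: "x \<in> part L \<alpha>" "m \<in> part M \<alpha>" "y \<in> part L \<beta>" "n \<in> part M \<beta>"
    using assms(2,3) by simp_all
  have "brk L x y \<in> part L (\<alpha> + \<beta>)" by (rule degree_closed(1)[OF hom(1,3)])
  moreover have "lact M x n + ract M m y + h x y \<in> part M (\<alpha> + \<beta>)"
    by (intro superspace_closed(2)[OF M_superspace] degree_closed(2)[OF hom(1,4)]
        degree_closed(3)[OF hom(3,2)] degree_closed(4)[OF assms(1) hom(1,3)])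
  ultimately show ?thesis by (simp add: uv del: add_bit_eq_xor)
qed

text \<open>
  The terms of the Leibniz identity that involve one element of \<open>M\<close> cancel by one module axiom each;
  the ones that involve none are the six terms of the coboundary.
\<close>

lemma leibniz_defect:
  assumes h: "h \<in> cochains2 L M"
    and u: "u \<in> part (E h) \<alpha>" and v: "v \<in> part (E h) \<beta>" and w: "w \<in> part (E h) \<gamma>"
  shows "brk (E h) u (brk (E h) v w) - signed \<alpha> \<beta> (brk (E h) v (brk (E h) u w)) - brk (E h) (brk (E h) u v) w
       = (0, delta2 L M h \<alpha> \<beta> (fst u) (fst v) (fst w))"
proof -
  obtain x m y n z p where uvw: "u = (x, m)" "v = (y, n)" "w = (z, p)" by (metis surj_pair)
  have hom: "x \<in> part L \<alpha>" "m \<in> part M \<alpha>" "y \<in> part L \<beta>" "n \<in> part M \<beta>" "z \<in> part L \<gamma>" "p \<in> part M \<gamma>"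
    using u v w by (simp_all add: uvw)
  have "brk L (brk L x y) z = brk L x (brk L y z) - signed \<alpha> \<beta> (brk L y (brk L x z))"
    "lact M (brk L x y) p = lact M x (lact M y p) - signed \<alpha> \<beta> (lact M y (lact M x p))"
    "ract M (lact M x n) z = lact M x (ract M n z) - signed \<alpha> \<beta> (ract M n (brk L x z))"
    "ract M (ract M m y) z = ract M m (brk L y z) - signed \<alpha> \<beta> (lact M y (ract M m z))"
    by (rule leibniz_identities(1)[OF hom(1,3,5)] leibniz_identities(2)[OF hom(1,3,6)]
        leibniz_identities(3)[OF hom(1,5,4)] leibniz_identities(4)[OF hom(3,5,2)])+
  then show ?thesis
    by (simp add: uvw delta2_def signed_Pair signed_add bilinear_simps)
qed

text \<open>
  The defect depends only on the components in \<open>L\<close>, and every homogeneous \<open>x\<close> in \<open>L\<close> is the component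
  of the homogeneous element \<open>(x, 0)\<close>.
\<close>

lemma cocycle_extension_leibniz_iff:
  assumes h: "h \<in> cochains2 L M"
  shows "leibniz_superalgebra (E h) \<longleftrightarrow> h \<in> cocycles2 L M"
proof -
  have deg: "\<forall>\<alpha> \<beta>. \<forall>u\<in>part (E h) \<alpha>. \<forall>v\<in>part (E h) \<beta>. brk (E h) u v \<in> part (E h) (\<alpha> + \<beta>)"
    by (intro allI ballI cochain_extension_degree[OF h])
  have diff: "a = b - c \<longleftrightarrow> b - c - a = 0" for a b c :: "'l \<times> 'm"
    unfolding right_minus_eq by (rule eq_commute)
  have "leibniz_superalgebra (E h) \<longleftrightarrow>
      (\<forall>\<alpha> \<beta> \<gamma>. \<forall>u\<in>part (E h) \<alpha>. \<forall>v\<in>part (E h) \<beta>. \<forall>w\<in>part (E h) \<gamma>.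
         brk (E h) u (brk (E h) v w) - signed \<alpha> \<beta> (brk (E h) v (brk (E h) u w))
           - brk (E h) (brk (E h) u v) w = 0)"
    unfolding leibniz_superalgebra_def diff
    by (intro iffI conjI deg cochain_extension_superspace cochain_extension_bilinear[OF h];
        (elim conjE)?; assumption)
  also have "\<dots> \<longleftrightarrow> (\<forall>\<alpha> \<beta> \<gamma>. \<forall>u\<in>part (E h) \<alpha>. \<forall>v\<in>part (E h) \<beta>. \<forall>w\<in>part (E h) \<gamma>.
         delta2 L M h \<alpha> \<beta> (fst u) (fst v) (fst w) = 0)"
    by (simp only: leibniz_defect[OF h] zero_prod_def prod.inject simp_thms cong: ball_cong)
  also have "\<dots> \<longleftrightarrow> (\<forall>\<alpha> \<beta> \<gamma>. \<forall>x\<in>part L \<alpha>. \<forall>y\<in>part L \<beta>. \<forall>z\<in>part L \<gamma>. delta2 L M h \<alpha> \<beta> x y z = 0)"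
  proof (intro iffI allI ballI)
    fix \<alpha> \<beta> \<gamma> x y z
    assume 0: "\<forall>\<alpha> \<beta> \<gamma>. \<forall>u\<in>part (E h) \<alpha>. \<forall>v\<in>part (E h) \<beta>. \<forall>w\<in>part (E h) \<gamma>.
        delta2 L M h \<alpha> \<beta> (fst u) (fst v) (fst w) = 0"
      and hom: "x \<in> part L \<alpha>" "y \<in> part L \<beta>" "z \<in> part L \<gamma>"
    have "(x, 0) \<in> part (E h) \<alpha>" "(y, 0) \<in> part (E h) \<beta>" "(z, 0) \<in> part (E h) \<gamma>"
      using hom superspace_closed(1)[OF M_superspace] by simp_all
    from 0[rule_format, OF this] show "delta2 L M h \<alpha> \<beta> x y z = 0" by simp
  next
    fix \<alpha> \<beta> \<gamma> u v w
    assume 0: "\<forall>\<alpha> \<beta> \<gamma>. \<forall>x\<in>part L \<alpha>. \<forall>y\<in>part L \<beta>. \<forall>z\<in>part L \<gamma>. delta2 L M h \<alpha> \<beta> x y z = 0"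
      and "u \<in> part (E h) \<alpha>" "v \<in> part (E h) \<beta>" "w \<in> part (E h) \<gamma>"
    then have "fst u \<in> part L \<alpha>" "fst v \<in> part L \<beta>" "fst w \<in> part L \<gamma>" by auto
    from 0[rule_format, OF this] show "delta2 L M h \<alpha> \<beta> (fst u) (fst v) (fst w) = 0" .
  qed
  finally show ?thesis using h by (simp add: cocycles2_def)
qed

lemma cocycle_extension_is_extension:
  assumes h: "h \<in> cocycles2 L M"
  shows "is_extension L M (cocycle_extension L M h)"
proof -
  have h': "h \<in> cochains2 L M" using h by (simp add: cocycles2_def)
  have "leibniz_hom (abelian_superalgebra M) (E h) (incl (cocycle_extension L M h))"
    using superspace_simps(1)[OF M_superspace] superspace_simps(1)[OF cochain_extension_superspace]
      superspace_closed(1)[OF L_superspace] superspace_simps(6)[OF L_superspace]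
    by (auto simp: leibniz_hom_def abelian_superalgebra_def Vector_Spaces.linear_iff bilinear_simps
        bilinear_map_simps[OF cochains2_bilinear[OF h']] zero_prod_def)
  moreover have "leibniz_hom (E h) L (proj (cocycle_extension L M h))"
    using superspace_simps(1)[OF L_superspace] superspace_simps(1)[OF cochain_extension_superspace]
    by (auto simp: leibniz_hom_def Vector_Spaces.linear_iff)
  moreover have "leibniz_superalgebra (E h)" using h h' cocycle_extension_leibniz_iff by blast
  moreover have "surj (proj (cocycle_extension L M h))"
    by (rule surjI[of _ "\<lambda>x. (x, 0)"]) simp
  ultimately show ?thesis
    by (auto simp: is_extension_def inj_def bilinear_simps
        bilinear_map_simps[OF cochains2_bilinear[OF h']])
qed

section \<open>Extensions and cohomology classes\<close>

lemma is_extensionD: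
  assumes "is_extension L M X"
  shows "superspace (middle X)" "bilinear_map (scl (middle X)) (scl (middle X)) (scl (middle X)) (brk (middle X))"
    "a \<in> part (middle X) \<alpha> \<Longrightarrow> b \<in> part (middle X) \<beta> \<Longrightarrow> brk (middle X) a b \<in> part (middle X) (\<alpha> + \<beta>)"
    "Vector_Spaces.linear (scl M) (scl (middle X)) (incl X)" "m \<in> part M \<alpha> \<Longrightarrow> incl X m \<in> part (middle X) \<alpha>"
    "Vector_Spaces.linear (scl (middle X)) (scl L) (proj X)" "x \<in> part (middle X) \<alpha> \<Longrightarrow> proj X x \<in> part L \<alpha>"
    "proj X (brk (middle X) x y) = brk L (proj X x) (proj X y)"
    "inj (incl X)" "proj X x = 0 \<longleftrightarrow> x \<in> range (incl X)" "surj (proj X)"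
    "brk (middle X) x (incl X m) = incl X (lact M (proj X x) m)"
    "brk (middle X) (incl X m) x = incl X (ract M m (proj X x))"
  using assms
  by (auto simp: is_extension_def leibniz_superalgebra_def leibniz_hom_def abelian_superalgebra_def)

text \<open>
  The short five lemma, which uses only the exactness of the two sequences. This matters when \<open>\<theta>\<close> serves
  to prove the Leibniz identity of \<open>E h\<close>: the bijectivity of \<open>\<theta>\<close> has to come before it.
\<close>

lemma cochain_extension_morphism_bij:
  assumes X: "is_extension L M X" and \<theta>: "Vector_Spaces.linear (scl (E h)) (scl (middle X)) \<theta>"
    and comm: "\<And>m. \<theta> (0, m) = incl X m" "\<And>x m. proj X (\<theta> (x, m)) = x"
  shows "bij \<theta>"
proof (rule short_five_bij)
  note XD = is_extensionD[OF X]
  show "Modules.additive \<theta>" "Modules.additive (incl X)" "Modules.additive (proj X)"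
    using \<theta> XD(4,6) by (auto intro: linear_imp_additive)
  show "Modules.additive (Pair 0 :: 'm \<Rightarrow> 'l \<times> 'm)" "Modules.additive (fst :: 'l \<times> 'm \<Rightarrow> 'l)"
    by (simp_all add: Modules.additive_def)
  show "{x::'l \<times> 'm. fst x = 0} = range (Pair 0)" by auto
  show "surj (fst :: 'l \<times> 'm \<Rightarrow> 'l)" by (rule surjI[of _ "\<lambda>x. (x, 0)"]) simp
qed (use comm is_extensionD(9,10)[OF X] in auto)

text \<open>
  An equivalence is a shear \<open>(x, m) \<mapsto> (x, f x + m)\<close>, and it preserves brackets iff \<open>g - h\<close> is the
  coboundary of \<open>f\<close>.
\<close>

lemma ext_equivalent_iff_coboundary:
  assumes g: "g \<in> cocycles2 L M" and h: "h \<in> cocycles2 L M"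
  shows "ext_equivalent (cocycle_extension L M g) (cocycle_extension L M h) \<longleftrightarrow>
    (\<lambda>x y. g x y - h x y) \<in> coboundaries2 L M"
proof
  assume "ext_equivalent (cocycle_extension L M g) (cocycle_extension L M h)"
  then obtain \<psi> where \<psi>: "leibniz_hom (E g) (E h) \<psi>" and inc: "\<And>m. \<psi> (0, m) = (0, m)"
    and pr: "\<And>v. proj (cocycle_extension L M h) (\<psi> v) = proj (cocycle_extension L M g) v"
    by (auto simp: ext_equivalent_def)
  note lin = leibniz_homD(1)[OF \<psi>]
  define f where "f x = snd (\<psi> (x, 0))" for x
  have \<psi>0: "\<psi> (x, 0) = (x, f x)" for x
    using pr[of "(x, 0)"] by (cases "\<psi> (x, 0)") (simp add: f_def)
  have \<psi>_eq: "\<psi> (x, m) = (x, f x + m)" for x m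
    using linear_map_simps(1)[OF lin, of "(x, 0)" "(0, m)"] by (simp add: \<psi>0 inc)
  have "f \<in> cochains1 L M"
  proof -
    have "f (x + y) = f x + f y" for x y
      using linear_map_simps(1)[OF lin, of "(x, 0)" "(y, 0)"] by (simp add: \<psi>_eq)
    moreover have "f (scl L c x) = scl M c (f x)" for c x
      using linear_map_simps(2)[OF lin, of c "(x, 0)"] superspace_simps(6)[OF M_superspace]
      by (simp add: \<psi>_eq)
    moreover have "f x \<in> part M \<alpha>" if "x \<in> part L \<alpha>" for x \<alpha>
      using leibniz_homD(2)[OF \<psi>, of "(x, 0)" \<alpha>] that superspace_closed(1)[OF M_superspace]
      by (simp add: \<psi>_eq)
    ultimately show ?thesis
      by (simp add: cochains1_def Vector_Spaces.linear_iff superspace_simps(1)[OF L_superspace]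
          superspace_simps(1)[OF M_superspace])
  qed
  moreover have "g x y - h x y = delta1 L M f x y" for x y
    using leibniz_homD(3)[OF \<psi>, of "(x, 0)" "(y, 0)"]
    by (simp add: \<psi>_eq bilinear_simps delta1_def algebra_simps)
  ultimately show "(\<lambda>x y. g x y - h x y) \<in> coboundaries2 L M"
    by (auto simp: coboundaries2_def image_iff fun_eq_iff)
next
  assume "(\<lambda>x y. g x y - h x y) \<in> coboundaries2 L M"
  then obtain f where f: "f \<in> cochains1 L M" and eq: "\<And>x y. g x y - h x y = delta1 L M f x y"
    by (auto simp: coboundaries2_def fun_eq_iff)
  have lin: "Vector_Spaces.linear (scl L) (scl M) f" and deg: "\<And>\<alpha> x. x \<in> part L \<alpha> \<Longrightarrow> f x \<in> part M \<alpha>"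
    using f by (auto simp: cochains1_def)
  define \<psi> where "\<psi> = (\<lambda>(x, m). (x, f x + m))"
  have g_eq: "g x y = h x y - f (brk L x y) + lact M x (f y) + ract M (f x) y" for x y
    using eq[of x y] by (simp add: delta1_def algebra_simps)
  have \<psi>: "leibniz_hom (E g) (E h) \<psi>"
    unfolding leibniz_hom_def
  proof (intro conjI allI ballI)
    show "Vector_Spaces.linear (scl (E g)) (scl (E h)) \<psi>"
      by (auto simp: \<psi>_def Vector_Spaces.linear_iff superspace_simps(1)[OF cochain_extension_superspace]
          linear_map_simps[OF lin] superspace_simps[OF M_superspace] algebra_simps)
    show "\<psi> v \<in> part (E h) \<alpha>" if "v \<in> part (E g) \<alpha>" for \<alpha> v
      using that deg superspace_closed(2)[OF M_superspace] by (auto simp: \<psi>_def)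
    show "\<psi> (brk (E g) u v) = brk (E h) (\<psi> u) (\<psi> v)" for u v
      by (cases u; cases v) (simp add: \<psi>_def g_eq bilinear_simps algebra_simps)
  qed
  have inc: "\<psi> (0, m) = (0, m)" for m
    by (simp add: \<psi>_def linear_map_simps[OF lin])
  have "bij \<psi>"
    using cochain_extension_morphism_bij[OF cocycle_extension_is_extension[OF h] leibniz_homD(1)[OF \<psi>]]
    by (simp add: inc) (simp add: \<psi>_def)
  then show "ext_equivalent (cocycle_extension L M g) (cocycle_extension L M h)"
    using \<psi> inc by (auto simp: ext_equivalent_def \<psi>_def)
qed

text \<open>
  For a linear section \<open>s\<close> of degree 0, the cocycle is the failure of \<open>s\<close> to preserve brackets, and
  \<open>(x, m) \<mapsto> s x + i m\<close> is the equivalence. The cocycle condition holds because the Leibniz identity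
  is transported back along this bijection.
\<close>

lemma extension_equivalent_to_cocycle_extension:
  fixes X :: "('k, 'l, 'm, 'e::ab_group_add) extension"
  assumes X: "is_extension L M X"
  obtains h where "h \<in> cocycles2 L M" "ext_equivalent (cocycle_extension L M h) X"
proof -
  note XD = is_extensionD[OF X]
  define A where "A = middle X"
  define i where "i = incl X"
  define p where "p = proj X"
  note D = XD[folded A_def i_def p_def]
  note i_simps = linear_map_simps[OF D(4)] and p_simps = linear_map_simps[OF D(6)]
    and A_simps = bilinear_map_simps[OF D(2)]
  obtain s where s: "Vector_Spaces.linear (scl L) (scl A) s" and ps: "\<And>x. p (s x) = x"
    and s_deg: "\<And>\<alpha> x. x \<in> part L \<alpha> \<Longrightarrow> s x \<in> part A \<alpha>"
    using graded_section[OF D(1) L_superspace D(6,7,11)] by blast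
  note s_simps = linear_map_simps[OF s]
  have pi: "p (i m) = 0" for m using D(10) by blast
  have "\<exists>m. i m = brk A (s x) (s y) - s (brk L x y)" for x y
  proof -
    have "p (brk A (s x) (s y) - s (brk L x y)) = 0" by (simp add: p_simps D(8) ps)
    then show ?thesis using D(10) by (metis imageE)
  qed
  then obtain h where ih: "\<And>x y. i (h x y) = brk A (s x) (s y) - s (brk L x y)" by metis
  have h: "h \<in> cochains2 L M"
  proof -
    have lin: "Vector_Spaces.linear (scl L) (scl A) (\<lambda>x. i (h x y))"
      "Vector_Spaces.linear (scl L) (scl A) (\<lambda>y. i (h x y))" for x y
      by (simp_all add: Vector_Spaces.linear_iff ih s_simps A_simps bilinear_simps
          superspace_simps(1)[OF L_superspace] superspace_simps[OF D(1)])
    have "bilinear_map (scl L) (scl L) (scl M) h"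
      unfolding bilinear_map_def
      using linear_cancel_inj[OF D(4,9) lin(1)] linear_cancel_inj[OF D(4,9) lin(2)] by auto
    moreover have "h x y \<in> part M (\<alpha> + \<beta>)" if "x \<in> part L \<alpha>" "y \<in> part L \<beta>" for \<alpha> \<beta> x y
    proof -
      have "i (h x y) \<in> part A (\<alpha> + \<beta>)"
        unfolding ih
        by (rule superspace_closed(5)[OF D(1) D(3)[OF s_deg[OF that(1)] s_deg[OF that(2)]]
              s_deg[OF degree_closed(1)[OF that]]])
      then obtain m where "m \<in> part M (\<alpha> + \<beta>)" "i m = i (h x y)"
        using homogeneous_preimage[OF M_superspace D(1,4,5)] by blast
      then show ?thesis using injD[OF D(9)] by blast
    qed
    ultimately show ?thesis by (simp add: cochains2_def)
  qed
  \<comment> \<open>The cochain \<open>h\<close> is chosen to make this map preserve brackets.\<close>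
  define \<theta> where "\<theta> = (\<lambda>(x, m). s x + i m)"
  have \<theta>_lin: "Vector_Spaces.linear (scl (E h)) (scl A) \<theta>"
    by (auto simp: Vector_Spaces.linear_iff \<theta>_def s_simps i_simps superspace_simps[OF D(1)]
        superspace_simps(1)[OF cochain_extension_superspace] algebra_simps)
  have \<theta>_brk: "\<theta> (brk (E h) u v) = brk A (\<theta> u) (\<theta> v)" for u v
  proof -
    obtain x m y n where "u = (x, m)" "v = (y, n)" by (metis surj_pair)
    then show ?thesis
      by (simp add: \<theta>_def i_simps ih A_simps D(12,13) p_simps ps pi bilinear_simps algebra_simps)
  qed
  have \<theta>_deg: "\<theta> u \<in> part A \<alpha>" if "u \<in> part (E h) \<alpha>" for \<alpha> u
    using that s_deg D(5) superspace_closed(2)[OF D(1)] by (auto simp: \<theta>_def)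
  have \<theta>_incl: "\<theta> (0, m) = i m" and \<theta>_proj: "p (\<theta> (x, m)) = x" for x m
    by (simp_all add: \<theta>_def s_simps p_simps ps pi)
  have bij: "bij \<theta>"
    using cochain_extension_morphism_bij[OF X, folded A_def i_def p_def, OF \<theta>_lin \<theta>_incl \<theta>_proj] .
  have "leibniz_superalgebra (E h)"
    unfolding leibniz_superalgebra_def
  proof (intro conjI allI ballI)
    fix \<alpha> \<beta> \<gamma> u v w
    assume "u \<in> part (E h) \<alpha>" "v \<in> part (E h) \<beta>" "w \<in> part (E h) \<gamma>"
    then have "brk A (brk A (\<theta> u) (\<theta> v)) (\<theta> w) =
        brk A (\<theta> u) (brk A (\<theta> v) (\<theta> w)) - signed \<alpha> \<beta> (brk A (\<theta> v) (brk A (\<theta> u) (\<theta> w)))"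
      using X \<theta>_deg unfolding is_extension_def leibniz_superalgebra_def A_def by blast
    then have "\<theta> (brk (E h) (brk (E h) u v) w) =
        \<theta> (brk (E h) u (brk (E h) v w) - signed \<alpha> \<beta> (brk (E h) v (brk (E h) u w)))"
      by (simp add: \<theta>_brk linear_map_simps[OF \<theta>_lin] signed_map[OF \<theta>_lin])
    then show "brk (E h) (brk (E h) u v) w =
        brk (E h) u (brk (E h) v w) - signed \<alpha> \<beta> (brk (E h) v (brk (E h) u w))"
      using bij by (simp add: bij_is_inj inj_eq)
  qed (use cochain_extension_superspace cochain_extension_bilinear[OF h] cochain_extension_degree[OF h] in auto)
  then have "h \<in> cocycles2 L M" using cocycle_extension_leibniz_iff[OF h] by blast
  moreover have "ext_equivalent (cocycle_extension L M h) X"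
    unfolding ext_equivalent_def leibniz_hom_def
    using \<theta>_lin \<theta>_deg \<theta>_brk bij \<theta>_incl \<theta>_proj
    unfolding A_def i_def p_def by (intro exI[of _ \<theta>]) auto
  ultimately show ?thesis using that by blast
qed

lemma cohomologous_iff_ext_rel:
  assumes "g \<in> cocycles2 L M" "h \<in> cocycles2 L M"
  shows "(g, h) \<in> cohomologous L M \<longleftrightarrow>
    (cocycle_extension L M g, cocycle_extension L M h) \<in> ext_rel L M"
  using assms
  by (simp add: cohomologous_def ext_rel_def cocycle_extension_is_extension ext_equivalent_iff_coboundary)

lemma equiv_cohomologous: "equiv (cocycles2 L M) (cohomologous L M)"
proof -
  have "cohomologous L M = {(g, h). g \<in> cocycles2 L M \<and> h \<in> cocycles2 L M \<and>
      (cocycle_extension L M g, cocycle_extension L M h) \<in> ext_rel L M}"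
    using cohomologous_iff_ext_rel by (auto simp: cohomologous_def)
  then show ?thesis
    using equiv_pullback[OF equiv_ext_rel[of L M], of "cocycles2 L M" "cocycle_extension L M"]
    by (simp add: cocycle_extension_is_extension)
qed

end

theorem theorem4p1:
  fixes L :: "('k::field, 'l::ab_group_add) superalgebra"
    and M :: "('k, 'l, 'm::ab_group_add) supermodule"
  assumes "leibniz_superalgebra L"
    and "leibniz_module L M"
  shows "(\<forall>h\<in>cocycles2 L M. is_extension L M (cocycle_extension L M h)) \<and>
         (\<exists>\<omega>. bij_betw \<omega> (cohomology2 L M) (ext_classes L M) \<and>
              (\<forall>h\<in>cocycles2 L M.
                 \<omega> (cohomologous L M `` {h}) = ext_rel L M `` {cocycle_extension L M h})) \<and>
         (\<forall>X :: ('k, 'l, 'm, 'e::ab_group_add) extension. is_extension L M X \<longrightarrow>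
            (\<exists>!C. C \<in> ext_classes L M \<and> (\<forall>Y\<in>C. ext_equivalent X Y)))"
proof (intro conjI ballI allI impI)
  interpret leibniz_superalgebra_with_module L M
    using assms by unfold_locales
  show "is_extension L M (cocycle_extension L M h)" if "h \<in> cocycles2 L M" for h
    using that by (rule cocycle_extension_is_extension)
  show "\<exists>\<omega>. bij_betw \<omega> (cohomology2 L M) (ext_classes L M) \<and>
              (\<forall>h\<in>cocycles2 L M.
                 \<omega> (cohomologous L M `` {h}) = ext_rel L M `` {cocycle_extension L M h})"
    unfolding cohomology2_def ext_classes_def
  proof (rule bij_betw_quotients[OF equiv_cohomologous equiv_ext_rel])
    fix Y :: "('k, 'l, 'm, 'l \<times> 'm) extension"
    assume "Y \<in> {X. is_extension L M X}"
    then show "\<exists>h\<in>cocycles2 L M. (cocycle_extension L M h, Y) \<in> ext_rel L M"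
      using extension_equivalent_to_cocycle_extension[of Y] cocycle_extension_is_extension
      by (auto simp: ext_rel_def)
  qed (simp_all add: cocycle_extension_is_extension cohomologous_iff_ext_rel)
  fix X :: "('k, 'l, 'm, 'e) extension"
  assume X: "is_extension L M X"
  obtain h where h: "h \<in> cocycles2 L M" and hX: "ext_equivalent (cocycle_extension L M h) X"
    using extension_equivalent_to_cocycle_extension[OF X] .
  note hE = cocycle_extension_is_extension[OF h]
  have Xh: "ext_equivalent X (cocycle_extension L M h)"
    using ext_equivalent_sym[OF hE X hX] .
  show "\<exists>!C. C \<in> ext_classes L M \<and> (\<forall>Y\<in>C. ext_equivalent X Y)"
  proof (intro ex1I conjI ballI)
    show "ext_rel L M `` {cocycle_extension L M h} \<in> ext_classes L M"
      unfolding ext_classes_def using hE by (intro quotientI) simp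
    show "ext_equivalent X Y" if "Y \<in> ext_rel L M `` {cocycle_extension L M h}" for Y
      using that ext_equivalent_trans[OF Xh] by (auto simp: ext_rel_def)
    \<comment> \<open>Any representative of \<open>C\<close> is equivalent to the cocycle extension by way of \<open>X\<close>.\<close>
    fix C assume C: "C \<in> ext_classes L M \<and> (\<forall>Y\<in>C. ext_equivalent X Y)"
    then obtain Y where Y: "is_extension L M Y" "C = ext_rel L M `` {Y}"
      by (auto simp: ext_classes_def elim!: quotientE)
    then have "Y \<in> C" using equiv_class_self[OF equiv_ext_rel] by blast
    then have "ext_equivalent X Y" using C by blast
    then have "(cocycle_extension L M h, Y) \<in> ext_rel L M"
      using ext_equivalent_trans[OF hX] hE Y(1) by (simp add: ext_rel_def)
    then show "C = ext_rel L M `` {cocycle_extension L M h}"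
      using equiv_class_eq[OF equiv_ext_rel] Y(2) by metis
  qed
qed

end
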